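(* For any tree $T$ with at least one edge, the set of leaves of $T$ is the unique MEG-set of $T$ of minimum size.
   Context: Two vertices $x,y$ of a graph $G$ monitor an edge $e$ if $e$ belongs to all shortest paths between $x$ and $y$. A set $S\subseteq V(G)$ is a monitoring edge-geodetic set (MEG-set) if for every edge $e$ of $G$ there is a pair $x,y\in S$ that monitors $e$. A leaf is a vertex of degree $1$. *)

theory Defs
  imports "Graph_Theory.Digraph_Component"
begin

text \<open>
  Finite simple undirected graphs are modelled by the locale \<^locale>\<open>graph\<close>: an undirected edge
  is represented by two opposite arcs. Edges are therefore taken to be the sets of end vertices of
  arcs, and the degree of a vertex is its \<^const>\<open>out_degree\<close>.
\<close>

definition edge_of :: "('a, 'b) pre_digraph \<Rightarrow> 'b \<Rightarrow> 'a set" where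
  "edge_of G a = {tail G a, head G a}"

definition edges :: "('a, 'b) pre_digraph \<Rightarrow> 'a set set" where
  "edges G = edge_of G ` arcs G"

text \<open>
  The library constant \<^const>\<open>Digraph_Component.forest\<close> forbids all directed cycles, hence also the
  walk \<open>a, b, a\<close> along a single undirected edge. Undirected cycles are the directed cycles
  of length at least 3.
\<close>

definition undirected_tree :: "('a, 'b) pre_digraph \<Rightarrow> bool" where
  "undirected_tree G \<longleftrightarrow>
     graph G \<and> Digraph_Component.connected G \<and> \<not> (\<exists>p. pre_digraph.cycle G p \<and> 3 \<le> length p)"

definition shortest_path :: "('a, 'b) pre_digraph \<Rightarrow> 'a \<Rightarrow> 'b awalk \<Rightarrow> 'a \<Rightarrow> bool" where
  "shortest_path G x p y \<longleftrightarrow>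
     pre_digraph.apath G x p y \<and> (\<forall>q. pre_digraph.apath G x q y \<longrightarrow> length p \<le> length q)"

text \<open>
  For vertices in different components the following condition holds vacuously; in a connected
  graph a shortest path always exists.
\<close>

definition monitors :: "('a, 'b) pre_digraph \<Rightarrow> 'a \<Rightarrow> 'a \<Rightarrow> 'a set \<Rightarrow> bool" where
  "monitors G x y e \<longleftrightarrow> (\<forall>p. shortest_path G x p y \<longrightarrow> e \<in> edge_of G ` set p)"

definition MEG_set :: "('a, 'b) pre_digraph \<Rightarrow> 'a set \<Rightarrow> bool" where
  "MEG_set G S \<longleftrightarrow> S \<subseteq> verts G \<and> (\<forall>e\<in>edges G. \<exists>x\<in>S. \<exists>y\<in>S. monitors G x y e)"

definition minimum_MEG_set :: "('a, 'b) pre_digraph \<Rightarrow> 'a set \<Rightarrow> bool" where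
  "minimum_MEG_set G S \<longleftrightarrow> MEG_set G S \<and> (\<forall>S'. MEG_set G S' \<longrightarrow> card S \<le> card S')"

definition leaves :: "('a, 'b) pre_digraph \<Rightarrow> 'a set" where
  "leaves G = {v \<in> verts G. out_degree G v = 1}"

end

theory Submission
  imports Defs
begin

text \<open>
  A leaf cannot be an interior vertex of a path, so the unique edge at a leaf is monitored only by
  pairs containing that leaf; hence every MEG-set contains all leaves. Conversely, a longest path
  through a given edge of a tree joins two leaves, and it is the only path between them, so these
  two leaves monitor the edge. The leaves thus form the least MEG-set with respect to inclusion.
\<close>

context graph
begin

section \<open>Reversal of paths and existence of shortest paths\<close>

lemma obtain_reverse_arc:
  assumes "a \<in> arcs G"
  obtains b where "b \<in> arcs G" "tail G b = head G a" "head G b = tail G a"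
  using assms sym_arcs unfolding symmetric_conv by metis

text \<open>Paths are directed while edges are not. Traversing the opposite arcs in reverse order
  lets facts about the start of a path be transferred to its end, and lets two paths with a common
  end be joined.\<close>

lemma reverse_apath:
  assumes "apath u p v"
  shows "\<exists>q. apath v q u \<and> length q = length p \<and> edge_of G ` set q = edge_of G ` set p
    \<and> set (awalk_verts v q) = set (awalk_verts u p)"
  using assms
proof (induction p arbitrary: u)
  case Nil
  then show ?case by (intro exI[of _ "[]"]) (auto simp: apath_Nil_iff)
next
  case (Cons a p)
  then have a: "a \<in> arcs G" "tail G a = u" and p: "apath (head G a) p v"
    and u: "u \<notin> set (awalk_verts (head G a) p)"
    by (auto simp: apath_Cons_iff)
  from Cons.IH[OF p] obtain q where q: "apath v q (head G a)" "length q = length p"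
    "edge_of G ` set q = edge_of G ` set p"
    "set (awalk_verts v q) = set (awalk_verts (head G a) p)"
    by auto
  from a(1) obtain b where b: "b \<in> arcs G" "tail G b = head G a" "head G b = tail G a"
    by (rule obtain_reverse_arc)
  have last: "awlast v q = head G a"
    using q(1) by (auto simp: apath_def)
  have path: "apath v (q @ [b]) u"
    using q u b a no_loops[OF a(1)] last
    by (auto simp: apath_append_iff apath_simps)
  then have "awalk_verts v (q @ [b]) = awalk_verts v q @ [u]"
    using b a last by (subst awalk_verts_append[of v q "[b]" u]) (auto simp: apath_def)
  then have "set (awalk_verts v (q @ [b])) = set (awalk_verts u (a # p))"
    using q a by auto
  moreover have "edge_of G ` set (q @ [b]) = edge_of G ` set (a # p)"
    using q b by (auto simp: edge_of_def)
  ultimately show ?case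
    using path q(2) by (intro exI[of _ "q @ [b]"]) auto
qed

lemma obtain_shortest_path:
  assumes "Digraph_Component.connected G" "x \<in> verts G" "y \<in> verts G"
  obtains p where "shortest_path G x p y"
proof -
  have "strongly_connected G"
    using sym_arcs assms(1) by (rule symmetric_connected_imp_strongly_connected)
  then have "x \<rightarrow>\<^sup>* y"
    using assms(2,3) by blast
  then obtain p where "apath x p y"
    by (auto simp: reachable_apath)
  then show ?thesis
    using ex_has_least_nat[of "\<lambda>p. apath x p y" p length] that
    by (auto simp: shortest_path_def)
qed

section \<open>Uniqueness of paths in trees\<close>

text \<open>Two different arcs leaving \<open>u\<close>, closed up by a detour that avoids
  \<open>u\<close>, would contain a cycle. Both the uniqueness of paths and the detection of leaves
  rest on this.\<close>

lemma tree_arc_unique_if_detour: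
  assumes T: "undirected_tree G"
    and a: "a \<in> arcs G" "tail G a = u" and b: "b \<in> arcs G" "tail G b = u"
    and w: "awalk (head G a) w (head G b)" "u \<notin> set (awalk_verts (head G a) w)"
  shows "a = b"
proof (rule ccontr)
  assume "a \<noteq> b"
  \<comment> \<open>Shortening \<open>w\<close> to a path makes its vertices distinct; all its arcs
    come from \<open>w\<close>, so \<open>u\<close> is still avoided.\<close>
  define r where "r = awalk_to_apath w"
  have r: "apath (head G a) r (head G b)"
    unfolding r_def using w(1) by (rule apath_awalk_to_apath)
  have "set r \<subseteq> set w"
    unfolding r_def using w(1) by (rule awalk_to_apath_subset)
  then have u: "u \<notin> set (awalk_verts (head G a) r)"
    using w(2) set_awalk_verts[OF w(1)] set_awalk_verts[OF awalkI_apath[OF r]] by auto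
  \<comment> \<open>Without parallel arcs the heads differ, so \<open>r\<close> has an arc and the
    cycle \<open>a # r @ [b']\<close> reaches the required length 3.\<close>
  have "head G a \<noteq> head G b"
    using \<open>a \<noteq> b\<close> no_multi_arcs a b by (auto simp: arc_to_ends_def)
  then have "r \<noteq> []"
    using r by (auto simp: apath_Nil_iff)
  obtain b' where b': "b' \<in> arcs G" "tail G b' = head G b" "head G b' = u"
    using b obtain_reverse_arc by metis
  have last: "awlast (head G a) r = head G b"
    using r by (auto simp: apath_def)
  have walk: "awalk (head G a) (r @ [b']) u"
    using r b' last by (auto simp: apath_def awalk_simps)
  have "awalk_verts (head G a) (r @ [b']) = awalk_verts (head G a) r @ [u]"
    using walk b' last by (subst awalk_verts_append) auto
  then have "distinct (tl (awalk_verts u (a # r @ [b'])))"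
    using r u by (auto simp: apath_def)
  moreover have "awalk u (a # r @ [b']) u"
    using walk a by (auto simp: awalk_Cons_iff)
  ultimately have "cycle (a # r @ [b'])"
    by (auto simp: cycle_def)
  moreover have "3 \<le> length (a # r @ [b'])"
    using \<open>r \<noteq> []\<close> by (cases r) auto
  ultimately show False
    using T unfolding undirected_tree_def by blast
qed

text \<open>By induction it suffices that the first arcs agree; the rests of the two paths meet in
  \<open>v\<close> and together form a detour that avoids \<open>u\<close>.\<close>

lemma tree_apath_unique:
  assumes T: "undirected_tree G" and "apath u p v" "apath u q v"
  shows "p = q"
  using assms(2,3)
proof (induction p arbitrary: u q)
  case Nil
  then show ?case
    using apath_nonempty_ends by (auto simp: apath_Nil_iff)
next
  case (Cons a p)
  have "q \<noteq> []"
    using Cons.prems apath_nonempty_ends[of u "a # p" v] by (auto simp: apath_Nil_iff)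
  then obtain b q' where q: "q = b # q'"
    by (cases q) auto
  from Cons.prems have a: "a \<in> arcs G" "tail G a = u" "apath (head G a) p v"
    "u \<notin> set (awalk_verts (head G a) p)"
    and b: "b \<in> arcs G" "tail G b = u" "apath (head G b) q' v"
    "u \<notin> set (awalk_verts (head G b) q')"
    unfolding q by (auto simp: apath_Cons_iff)
  from reverse_apath[OF b(3)] obtain r where r: "apath v r (head G b)"
    "set (awalk_verts v r) = set (awalk_verts (head G b) q')"
    by auto
  \<comment> \<open>The detour runs along \<open>p\<close> to \<open>v\<close> and back along the
    reverse of \<open>q'\<close>.\<close>
  have "awalk (head G a) (p @ r) (head G b)"
    using a(3) r(1) by (auto simp: apath_def intro: awalk_appendI)
  moreover have "u \<notin> set (awalk_verts (head G a) (p @ r))"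
    using set_awalk_verts_append[of "head G a" p v r "head G b"] a b r by (auto simp: apath_def)
  ultimately have "a = b"
    using tree_arc_unique_if_detour[OF T] a b by blast
  then show ?case
    using Cons.IH a b q by auto
qed

section \<open>Leaves as ends of paths\<close>

text \<open>By \<open>max\<close>, a second arc leaving \<open>u\<close> would lead back to a vertex
  of \<open>p\<close>, and the piece of \<open>p\<close> up to that vertex would be a detour
  avoiding \<open>u\<close>.\<close>

lemma tree_unextendable_apath_start_leaf:
  assumes T: "undirected_tree G" and p: "apath u p v" "p \<noteq> []"
    and max: "\<And>b. b \<in> arcs G \<Longrightarrow> head G b = u \<Longrightarrow> tail G b \<in> set (awalk_verts u p)"
  shows "u \<in> leaves G"
proof -
  obtain a p' where p': "p = a # p'"
    using p(2) by (cases p) auto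
  with p have a: "a \<in> arcs G" "tail G a = u" "apath (head G a) p' v"
    "u \<notin> set (awalk_verts (head G a) p')"
    by (auto simp: apath_Cons_iff)
  have "b = a" if b: "b \<in> arcs G" "tail G b = u" for b
  proof -
    obtain b' where b': "b' \<in> arcs G" "tail G b' = head G b" "head G b' = u"
      using b obtain_reverse_arc by metis
    \<comment> \<open>The head of \<open>b\<close> is not \<open>u\<close>, as there are no loops,
      so it lies on the remainder \<open>p'\<close>.\<close>
    have "head G b \<in> set (awalk_verts (head G a) p')"
      using max[of b'] b' no_loops[OF b(1)] a(2) b(2) p' by auto
    then obtain q r where q: "p' = q @ r" "awalk (head G a) q (head G b)" "awalk (head G b) r v"
      using awalk_decomp a(3) by (metis awalkI_apath)
    have "u \<notin> set (awalk_verts (head G a) q)"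
      using a(4) q set_awalk_verts_append[OF q(2,3)] by auto
    then show ?thesis
      using tree_arc_unique_if_detour[OF T a(1,2) b q(2)] by simp
  qed
  then have "out_arcs G u = {a}"
    unfolding out_arcs_def using a(1,2) by blast
  then show ?thesis
    using a by (auto simp: leaves_def out_degree_def)
qed

text \<open>A path through an interior vertex of degree 1 would have to leave by the reverse of the
  arc \<open>c\<close> on which it arrived, and so revisit the tail of \<open>c\<close>.\<close>

lemma leaf_on_apath_is_end:
  assumes p: "apath x p y" and v: "v \<in> set (awalk_verts x p)" and leaf: "v \<in> leaves G"
  shows "v = x \<or> v = y"
proof (rule ccontr)
  assume nv: "\<not> (v = x \<or> v = y)"
  obtain q r where qr: "p = q @ r" "awalk x q v" "awalk v r y"
    using awalk_decomp[OF awalkI_apath[OF p] v] by blast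
  have "q \<noteq> []" "r \<noteq> []"
    using qr nv by (auto simp: awalk_Nil_iff)
  then obtain q' c d r' where qr': "q = q' @ [c]" "r = d # r'"
    by (metis list.exhaust rev_exhaust)
  have c: "c \<in> arcs G" "head G c = v" and d: "d \<in> arcs G" "tail G d = v"
    using qr qr' by (auto simp: awalk_simps)
  obtain c' where c': "c' \<in> arcs G" "tail G c' = v" "head G c' = tail G c"
    using c obtain_reverse_arc by metis
  obtain f where "out_arcs G v = {f}"
    using leaf by (auto simp: leaves_def out_degree_def card_1_singleton_iff)
  then have "c' = d"
    using c' d by (metis in_out_arcs_conv singletonD)
  then have "head G d = tail G c"
    using c' by simp
  moreover have "apath (tail G c) (c # d # r') y"
    using p qr(1) qr' by (auto simp: apath_append_iff apath_Cons_iff)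
  moreover have "head G d \<in> set (awalk_verts (head G d) r')"
    using qr qr' by (auto simp: awalk_Cons_iff intro: hd_in_awalk_verts)
  ultimately show False
    by (auto simp: apath_Cons_iff)
qed

section \<open>Leaves and MEG-sets\<close>

text \<open>Connectedness excludes vacuous monitoring: a shortest path between the monitoring pair
  exists and contains the edge at the leaf.\<close>

lemma leaves_subset_MEG_set:
  assumes conn: "Digraph_Component.connected G" and S: "MEG_set G S"
  shows "leaves G \<subseteq> S"
proof
  fix v assume v: "v \<in> leaves G"
  then obtain a where "out_arcs G v = {a}"
    by (auto simp: leaves_def out_degree_def card_1_singleton_iff)
  then have a: "a \<in> arcs G" "tail G a = v"
    by (metis in_out_arcs_conv singletonI)+
  then obtain x y where xy: "x \<in> S" "y \<in> S" "monitors G x y (edge_of G a)"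
    using S by (auto simp: MEG_set_def edges_def)
  moreover have "S \<subseteq> verts G"
    using S by (simp add: MEG_set_def)
  ultimately obtain p where p: "shortest_path G x p y"
    using obtain_shortest_path[OF conn] by blast
  then obtain c where "c \<in> set p" "edge_of G c = edge_of G a"
    using xy(3) by (metis imageE monitors_def)
  moreover have "apath x p y"
    using p by (simp add: shortest_path_def)
  \<comment> \<open>The arcs \<open>c\<close> and \<open>a\<close> may be opposite, so
    \<open>v\<close> can be the tail or the head of \<open>c\<close>.\<close>
  ultimately have "v \<in> set (awalk_verts x p)"
    using a(2) awalk_verts_arc1[of c p x] awalk_verts_arc2[of x p y c]
    by (auto simp: edge_of_def doubleton_eq_iff apath_def)
  then show "v \<in> S"
    using leaf_on_apath_is_end[OF \<open>apath x p y\<close>] v xy by blast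
qed

lemma tree_edge_on_leaf_path:
  assumes T: "undirected_tree G" and e: "e \<in> edges G"
  obtains x p y where "x \<in> leaves G" "y \<in> leaves G" "apath x p y" "e \<in> edge_of G ` set p"
proof -
  define P where "P p \<longleftrightarrow> (\<exists>x y. apath x p y) \<and> e \<in> edge_of G ` set p" for p
  obtain a where a: "a \<in> arcs G" "e = edge_of G a"
    using e by (auto simp: edges_def)
  then have "P [a]"
    using no_loops[OF a(1)] by (auto simp: P_def apath_simps)
  \<comment> \<open>This bound ensures that a longest path through \<open>e\<close> exists.\<close>
  moreover have "\<forall>p. P p \<longrightarrow> length p < card (verts G)"
    using length_apath_less by (auto simp: P_def)
  ultimately obtain p where p: "P p" and longest: "\<And>q. P q \<Longrightarrow> length q \<le> length p"
    using ex_has_greatest_nat[of P "[a]" length] by blast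
  \<comment> \<open>Stated for every path of maximal length through \<open>e\<close>, so that it
    applies to \<open>p\<close> and to its reverse.\<close>
  have start_leaf: "u \<in> leaves G"
    if q: "apath u q v" "e \<in> edge_of G ` set q" "length q = length p" for u q v
  proof (rule tree_unextendable_apath_start_leaf[OF T q(1)])
    show "q \<noteq> []"
      using q(2) by auto
    fix b assume b: "b \<in> arcs G" "head G b = u"
    show "tail G b \<in> set (awalk_verts u q)"
    proof (rule ccontr)
      assume "tail G b \<notin> set (awalk_verts u q)"
      then have "apath (tail G b) (b # q) v"
        using b q by (auto simp: apath_Cons_iff)
      then have "P (b # q)"
        using q by (auto simp: P_def)
      then show False
        using longest q(3) by fastforce
    qed
  qed
  obtain x y where xy: "apath x p y" "e \<in> edge_of G ` set p"
    using p by (auto simp: P_def)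
  obtain q where "apath y q x" "length q = length p" "edge_of G ` set q = edge_of G ` set p"
    using reverse_apath[OF xy(1)] by blast
  then show ?thesis
    using that start_leaf xy by metis
qed

lemma tree_leaves_MEG_set:
  assumes T: "undirected_tree G"
  shows "MEG_set G (leaves G)"
  unfolding MEG_set_def
proof (intro conjI ballI)
  show "leaves G \<subseteq> verts G"
    by (auto simp: leaves_def)
next
  fix e assume "e \<in> edges G"
  with T obtain x p y where p: "x \<in> leaves G" "y \<in> leaves G" "apath x p y"
    "e \<in> edge_of G ` set p"
    by (rule tree_edge_on_leaf_path)
  have "monitors G x y e"
    using tree_apath_unique[OF T p(3)] p(4) by (auto simp: monitors_def shortest_path_def)
  with p show "\<exists>x\<in>leaves G. \<exists>y\<in>leaves G. monitors G x y e"
    by blast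
qed

end

theorem theorem1:
  fixes T :: "('a, 'b) pre_digraph"
  assumes "undirected_tree T"
    and "edges T \<noteq> {}"
  shows "minimum_MEG_set T (leaves T) \<and> (\<forall>S. minimum_MEG_set T S \<longrightarrow> S = leaves T)"
proof -
  interpret graph T
    using assms(1) by (simp add: undirected_tree_def)
  have MEG: "MEG_set T (leaves T)"
    using assms(1) by (rule tree_leaves_MEG_set)
  \<comment> \<open>Finiteness is what turns inclusion into a comparison of cardinalities, since
    \<open>card\<close> is 0 on infinite sets.\<close>
  have least: "leaves T \<subseteq> S" "finite S" if "MEG_set T S" for S
    using that assms(1) leaves_subset_MEG_set finite_subset[OF _ finite_verts]
    by (auto simp: undirected_tree_def MEG_set_def)
  have "S = leaves T" if "minimum_MEG_set T S" for S
  proof -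
    have "MEG_set T S" "card S \<le> card (leaves T)"
      using that MEG by (auto simp: minimum_MEG_set_def)
    then show ?thesis
      using least by (metis card_seteq)
  qed
  moreover have "minimum_MEG_set T (leaves T)"
    using MEG least by (auto simp: minimum_MEG_set_def intro: card_mono)
  ultimately show ?thesis
    by blast
qed

end
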